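(* Let $A\subset\mathbb{R}^n$, let $x\in\overline A$, and let $\xi_1,\dots,\xi_k\in\mathrm{Eff}_x^{\mathbb P}(A)$ be a Point-Cross exhaustive packet at $x$. Set \[ d_i:=\theta_x^A(\xi_i),\qquad D:=\sum_{i=1}^k d_i. \] Assume that, for some oriented representatives $v_i\in\xi_i$ (unit vectors), the directions $v_1,\dots,v_k$ produce a product-grid realization of type $(v_i,d_i)_{i=1}^k$ at $x$. Assume moreover that $A$ has pointwise upper-box covering control of exponent $D$ at $x$. Then \[ \dim_{\mathrm{Pbox}}\{x\}_A=\dim_{\times}\{x\}_A=D. \]
   Context: Tangent cone: $\mathrm{Tan}_x(A)$ is the set of $v\in\mathbb{R}^n$ for which there exist $x_k\in A$, $x_k\to x$, and positive reals $\lambda_k\downarrow0$ with $(x_k-x)/\lambda_k\to v$. Effective directions: $\mathrm{Eff}_x(A):=\mathrm{Tan}_x(A)\cap S^{n-1}$ if $x\in\overline A$ (and $\varnothing$ otherwise). For $v\ne0$ let $[v]=\mathbb{R}v\in\mathbb{P}^{n-1}$; $\mathrm{Eff}_x^{\mathbb P}(A):=\{[v]:v\in\mathrm{Eff}_x(A)\}$. Admissible probes: for $x\in\overline A$, $v\in S^{n-1}$, $\mathcal G_x^A(v)$ is the family of all injective Lipschitz maps $\gamma:[0,\delta]\to\mathbb{R}^n$ (some $\delta>0$) with $\gamma(0)=x$, $\lim_{t\to0^+}\frac{\gamma(t)-x}{\|\gamma(t)-x\|}=v$, and $A\cap\gamma((0,\eta])\ne\varnothing$ for every $\eta\in(0,\delta]$;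 $\Gamma_\gamma:=\gamma([0,\delta])$. Point-extended box dimension: for bounded $E$, $N_\varepsilon(E)$ is the minimal number of sets of diameter at most $\varepsilon$ covering $E$ and $\overline{\dim}_B(E):=\limsup_{\varepsilon\to0}\frac{\ln N_\varepsilon(E)}{\ln(1/\varepsilon)}$. For $x\in\overline E$, $\dim_{\mathrm{Pbox}}\{x\}_E:=\inf_{r>0}\overline{\dim}_B(E\cap B(x,r))$; it is $0$ if $x\notin\overline E$. Directional contribution: for $v\in\mathrm{Eff}_x(A)$, $\theta_x^A(v):=\sup_{\gamma\in\mathcal G_x^A(v)}\dim_{\mathrm{Pbox}}\{x\}_{A\cap\Gamma_\gamma}$; for $\xi\in\mathrm{Eff}_x^{\mathbb P}(A)$, $\theta_x^A(\xi):=\sup\{\theta_x^A(w):w\in\mathrm{Eff}_x(A),[w]=\xi\}$. (These values lie in $[0,1]$.) Point-Cross dimension at $x\in\overline A$: $\dim_\times\{x\}_A:=\sup\sum_{i=1}^m\theta_x^A(\xi_i)$ over all $m\in\{0,\dots,n\}$ and all $\xi_1,\dots,\xi_m\in\mathrm{Eff}_x^{\mathbb P}(A)$ that are projectively independent, i.e. nonzero representatives are linearly independent (empty family allowed, with sum $0$). Point-Cross exhaustive packet at $x$: projectively independent directions $\xi_1,\dots,\xi_k\in\mathrm{Eff}_x^{\mathbb P}(A)$ with $\dim_\times\{x\}_A=\sum_{i=1}^k\theta_x^A(\xi_i)$. Product-grid realization: for linearly independent $v_1,\dots,v_k\in S^{n-1}$ and $d_1,\dots,d_k\in[0,1]$,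 $A$ admits a product-grid realization of type $(v_i,d_i)_{i=1}^k$ at $x$ if there exist constants $C\ge1$ and $c>0$ such that, for every $\rho_0>0$, every $0<\rho<\rho_0$, and every $\eta>0$, there are scales $\varepsilon_m\downarrow0$ with $0<\varepsilon_m<\rho$, and finite sets $P_{i,m}\subset[-\rho,\rho]$ satisfying $\#P_{i,m}\ge(\rho/\varepsilon_m)^{d_i-\eta}$ for $i=1,\dots,k$, and such that $G_m:=\{x+\sum_{i=1}^k t_iv_i:t_i\in P_{i,m}\}$ is contained in $A\cap B(x,C\rho)$ and is $c\varepsilon_m$-separated (distinct points are at distance at least $c\varepsilon_m$). Pointwise upper-box covering control of exponent $d$ at $x$ ($d\in[0,n]$): for every sufficiently small $R>0$ and every $\eta>0$, there exist $C_{R,\eta}>0$ and $\varepsilon_{R,\eta}>0$ such that, for every $0<\varepsilon<\varepsilon_{R,\eta}$, $N_\varepsilon(A\cap B(x,R))\le C_{R,\eta}(R/\varepsilon)^{d+\eta}$. *)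

theory Defs
  imports "HOL-Analysis.Analysis"
begin

text \<open>
  Dimensions are valued in \<open>ennreal\<close>, i.e. in \<open>[0,\<infinity>]\<close>, so all suprema and infima are those of
  a complete lattice. \<open>B(x,r)\<close> is the open ball, and a line \<open>[v] = \<real>v\<close> is the set \<open>span {v}\<close>.
\<close>

subsection \<open>Directions\<close>

definition tangent_cone :: "real^'n \<Rightarrow> (real^'n) set \<Rightarrow> (real^'n) set" where
  "tangent_cone x A =
    {v. \<exists>(X :: nat \<Rightarrow> real^'n) (l :: nat \<Rightarrow> real).
          (\<forall>k. X k \<in> A) \<and> X \<longlonglongrightarrow> x \<and> (\<forall>k. l k > 0) \<and> decseq l \<and> l \<longlonglongrightarrow> 0 \<and>
          (\<lambda>k. (X k - x) /\<^sub>R l k) \<longlonglongrightarrow> v}"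

definition eff_dirs :: "real^'n \<Rightarrow> (real^'n) set \<Rightarrow> (real^'n) set" where
  "eff_dirs x A = (if x \<in> closure A then tangent_cone x A \<inter> sphere 0 1 else {})"

definition proj_class :: "real^'n \<Rightarrow> (real^'n) set" where
  "proj_class v = span {v}"

definition proj_eff_dirs :: "real^'n \<Rightarrow> (real^'n) set \<Rightarrow> (real^'n) set set" where
  "proj_eff_dirs x A = proj_class ` eff_dirs x A"

definition lin_indep_family :: "nat \<Rightarrow> (nat \<Rightarrow> real^'n) \<Rightarrow> bool" where
  "lin_indep_family k v \<longleftrightarrow> inj_on v {1..k} \<and> independent (v ` {1..k})"

definition proj_independent :: "nat \<Rightarrow> (nat \<Rightarrow> (real^'n) set) \<Rightarrow> bool" where
  "proj_independent k \<xi> \<longleftrightarrow>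
    (\<exists>u. (\<forall>i\<in>{1..k}. u i \<noteq> 0 \<and> \<xi> i = proj_class (u i)) \<and> lin_indep_family k u)"

subsection \<open>Box dimension\<close>

text \<open>The condition \<^term>\<open>bounded U\<close> is needed because \<^const>\<open>diameter\<close> is unspecified on unbounded sets.\<close>

definition covering_number :: "real \<Rightarrow> 'a::metric_space set \<Rightarrow> nat" where
  "covering_number \<epsilon> E =
    (LEAST N. \<exists>F. finite F \<and> card F = N \<and> (\<forall>U\<in>F. bounded U \<and> diameter U \<le> \<epsilon>) \<and> E \<subseteq> \<Union>F)"

definition upper_box_dim :: "'a::metric_space set \<Rightarrow> ennreal" where
  "upper_box_dim E =
    Limsup (at_right 0) (\<lambda>\<epsilon>. ennreal (ln (real (covering_number \<epsilon> E)) / ln (1 / \<epsilon>)))"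

definition pbox_dim :: "'a::metric_space \<Rightarrow> 'a set \<Rightarrow> ennreal" where
  "pbox_dim x E =
    (if x \<in> closure E then (INF r\<in>{0<..}. upper_box_dim (E \<inter> ball x r)) else 0)"

subsection \<open>Directional contributions and the Point-Cross dimension\<close>

text \<open>A probe \<open>\<gamma> : [0,\<delta>] \<rightarrow> \<real>\<^sup>n\<close> is a pair \<open>(\<delta>, \<gamma>)\<close>; the values of \<open>\<gamma>\<close> outside \<open>[0,\<delta>]\<close> are irrelevant.\<close>

definition probes :: "real^'n \<Rightarrow> (real^'n) set \<Rightarrow> real^'n \<Rightarrow> (real \<times> (real \<Rightarrow> real^'n)) set" where
  "probes x A v =
    {(\<delta>, \<gamma>). \<delta> > 0 \<and> inj_on \<gamma> {0..\<delta>} \<and> (\<exists>L. L-lipschitz_on {0..\<delta>} \<gamma>) \<and> \<gamma> 0 = x \<and>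
       ((\<lambda>t. (\<gamma> t - x) /\<^sub>R norm (\<gamma> t - x)) \<longlongrightarrow> v) (at_right 0) \<and>
       (\<forall>\<eta>\<in>{0<..\<delta>}. A \<inter> \<gamma> ` {0<..\<eta>} \<noteq> {})}"

definition dir_contribution :: "real^'n \<Rightarrow> (real^'n) set \<Rightarrow> real^'n \<Rightarrow> ennreal" where
  "dir_contribution x A v = (SUP (\<delta>, \<gamma>)\<in>probes x A v. pbox_dim x (A \<inter> \<gamma> ` {0..\<delta>}))"

definition proj_contribution :: "real^'n \<Rightarrow> (real^'n) set \<Rightarrow> (real^'n) set \<Rightarrow> ennreal" where
  "proj_contribution x A \<xi> =
    (SUP w\<in>{w \<in> eff_dirs x A. proj_class w = \<xi>}. dir_contribution x A w)"

definition cross_dim :: "real^'n \<Rightarrow> (real^'n) set \<Rightarrow> ennreal" where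
  "cross_dim x A =
    (SUP (m, \<xi>)\<in>{(m, \<xi>). m \<le> CARD('n) \<and> (\<forall>i\<in>{1..m}. \<xi> i \<in> proj_eff_dirs x A) \<and> proj_independent m \<xi>}.
      \<Sum>i=1..m. proj_contribution x A (\<xi> i))"

definition exhaustive_packet ::
    "real^'n \<Rightarrow> (real^'n) set \<Rightarrow> nat \<Rightarrow> (nat \<Rightarrow> (real^'n) set) \<Rightarrow> bool" where
  "exhaustive_packet x A k \<xi> \<longleftrightarrow>
    (\<forall>i\<in>{1..k}. \<xi> i \<in> proj_eff_dirs x A) \<and> proj_independent k \<xi> \<and>
    cross_dim x A = (\<Sum>i=1..k. proj_contribution x A (\<xi> i))"

subsection \<open>Product grids and covering control\<close>

definition grid :: "real^'n \<Rightarrow> nat \<Rightarrow> (nat \<Rightarrow> real^'n) \<Rightarrow> (nat \<Rightarrow> real set) \<Rightarrow> (real^'n) set" where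
  "grid x k v P = {x + (\<Sum>i=1..k. t i *\<^sub>R v i) | t. \<forall>i\<in>{1..k}. t i \<in> P i}"

definition separated_by :: "real \<Rightarrow> 'a::metric_space set \<Rightarrow> bool" where
  "separated_by s G \<longleftrightarrow> (\<forall>p\<in>G. \<forall>q\<in>G. p \<noteq> q \<longrightarrow> dist p q \<ge> s)"

definition product_grid_realization ::
    "(real^'n) set \<Rightarrow> real^'n \<Rightarrow> nat \<Rightarrow> (nat \<Rightarrow> real^'n) \<Rightarrow> (nat \<Rightarrow> real) \<Rightarrow> bool" where
  "product_grid_realization A x k v d \<longleftrightarrow>
    lin_indep_family k v \<and> (\<forall>i\<in>{1..k}. v i \<in> sphere 0 1 \<and> d i \<in> {0..1}) \<and>
    (\<exists>C\<ge>1. \<exists>c>0. \<forall>\<rho>\<^sub>0>0. \<forall>\<rho>. 0 < \<rho> \<and> \<rho> < \<rho>\<^sub>0 \<longrightarrow> (\<forall>\<eta>>0.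
      \<exists>(\<epsilon> :: nat \<Rightarrow> real) (P :: nat \<Rightarrow> nat \<Rightarrow> real set).
        decseq \<epsilon> \<and> \<epsilon> \<longlonglongrightarrow> 0 \<and>
        (\<forall>m. 0 < \<epsilon> m \<and> \<epsilon> m < \<rho> \<and>
          (\<forall>i\<in>{1..k}. finite (P i m) \<and> P i m \<subseteq> {-\<rho>..\<rho>} \<and>
             real (card (P i m)) \<ge> (\<rho> / \<epsilon> m) powr (d i - \<eta>)) \<and>
          grid x k v (\<lambda>i. P i m) \<subseteq> A \<inter> ball x (C * \<rho>) \<and>
          separated_by (c * \<epsilon> m) (grid x k v (\<lambda>i. P i m)))))"

definition upper_box_covering_control :: "(real^'n) set \<Rightarrow> real^'n \<Rightarrow> real \<Rightarrow> bool" where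
  "upper_box_covering_control A x d \<longleftrightarrow>
    d \<in> {0..real CARD('n)} \<and>
    (\<exists>R\<^sub>0>0. \<forall>R. 0 < R \<and> R < R\<^sub>0 \<longrightarrow> (\<forall>\<eta>>0. \<exists>C>0. \<exists>\<epsilon>\<^sub>0>0. \<forall>\<epsilon>. 0 < \<epsilon> \<and> \<epsilon> < \<epsilon>\<^sub>0 \<longrightarrow>
       real (covering_number \<epsilon> (A \<inter> ball x R)) \<le> C * (R / \<epsilon>) powr (d + \<eta>)))"

end

theory Submission imports Defs begin

text \<open>
  The covering control bounds the box dimension of \<open>A\<close> near \<open>x\<close> by \<open>D\<close>. By monotonicity it also
  bounds every directional contribution, so these are finite and the Point-Cross dimension is
  \<open>D\<close>. For the lower bound, the product grid of radius \<open>\<rho>\<close> is a \<open>c \<epsilon>\<^sub>m\<close>-separated subset of \<open>A\<close> with at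
  least \<open>(\<rho> / \<epsilon>\<^sub>m) powr (D - k \<eta>)\<close> points, and a set of diameter less than \<open>c \<epsilon>\<^sub>m\<close> contains at most
  one of them.
\<close>

subsection \<open>Covering numbers\<close>

lemma covering_number_le_card:
  assumes "finite F" "\<forall>U\<in>F. bounded U \<and> diameter U \<le> \<epsilon>" "E \<subseteq> \<Union>F"
  shows "covering_number \<epsilon> E \<le> card F"
  unfolding covering_number_def by (rule Least_le) (use assms in blast)

text \<open>\<open>LEAST\<close> is informative only once some finite cover exists. Compactness of
  the closure supplies one: finitely many balls of radius \<epsilon>/2, each of diameter at most
  \<epsilon>.\<close>

lemma covering_number_attained:
  fixes E :: "'a::euclidean_space set"
  assumes "bounded E" "\<epsilon> > 0"
  obtains F where "finite F" "card F = covering_number \<epsilon> E"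
    "\<forall>U\<in>F. bounded U \<and> diameter U \<le> \<epsilon>" "E \<subseteq> \<Union>F"
proof -
  have "compact (closure E)"
    using assms(1) by simp
  then obtain S where S: "finite S" "closure E \<subseteq> (\<Union>p\<in>S. ball p (\<epsilon>/2))"
    using assms(2) unfolding compact_eq_totally_bounded by (meson half_gt_zero)
  let ?P = "\<lambda>N. \<exists>F. finite F \<and> card F = N \<and> (\<forall>U\<in>F. bounded U \<and> diameter U \<le> \<epsilon>) \<and> E \<subseteq> \<Union>F"
  have "?P (card ((\<lambda>p. ball p (\<epsilon>/2)) ` S))"
  proof (intro exI conjI ballI)
    show "E \<subseteq> \<Union>((\<lambda>p. ball p (\<epsilon>/2)) ` S)"
      using S(2) closure_subset[of E] by blast
  qed (use S(1) assms(2) in auto)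
  then have "?P (covering_number \<epsilon> E)"
    unfolding covering_number_def by (rule LeastI)
  then show thesis
    by (elim exE conjE) (rule that)
qed

lemma covering_number_mono:
  fixes E :: "'a::euclidean_space set"
  assumes "E \<subseteq> E'" "bounded E'" "\<epsilon> > 0"
  shows "covering_number \<epsilon> E \<le> covering_number \<epsilon> E'"
proof -
  obtain F where F: "finite F" "card F = covering_number \<epsilon> E'"
    "\<forall>U\<in>F. bounded U \<and> diameter U \<le> \<epsilon>" "E' \<subseteq> \<Union>F"
    by (rule covering_number_attained[OF assms(2,3)])
  then show ?thesis
    using covering_number_le_card[OF F(1,3), of E] assms(1) by auto
qed

text \<open>Pigeonhole: send each point of \<open>G\<close> to a member of a minimal cover
  containing it. Two points with the same image would be at distance at most
  \<open>\<epsilon> < s\<close>, so this map is injective.\<close>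

lemma card_separated_le_covering_number:
  fixes E :: "'a::euclidean_space set"
  assumes "separated_by s G" "G \<subseteq> E" "bounded E" "0 < \<epsilon>" "\<epsilon> < s"
  shows "card G \<le> covering_number \<epsilon> E"
proof -
  obtain F where F: "finite F" "card F = covering_number \<epsilon> E"
    "\<forall>U\<in>F. bounded U \<and> diameter U \<le> \<epsilon>" "E \<subseteq> \<Union>F"
    by (rule covering_number_attained[OF assms(3,4)])
  have "\<forall>p\<in>G. \<exists>U\<in>F. p \<in> U"
    using F(4) assms(2) by blast
  then obtain f where f: "\<And>p. p \<in> G \<Longrightarrow> f p \<in> F \<and> p \<in> f p"
    by metis
  have "inj_on f G"
  proof (rule inj_onI, rule ccontr)
    fix p q assume pq: "p \<in> G" "q \<in> G" "f p = f q" "p \<noteq> q"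
    then have "dist p q \<le> diameter (f p)"
      using f[of p] f[of q] F(3) by (intro diameter_bounded_bound) auto
    also have "\<dots> \<le> \<epsilon>"
      using f[of p] F(3) pq(1) by blast
    finally show False
      using assms(1,5) pq unfolding separated_by_def by force
  qed
  then show ?thesis
    using card_inj_on_le[of f G F] f F(1,2) by auto
qed

subsection \<open>Upper box dimension\<close>

text \<open>Since \<open>ln (1/\<epsilon>)\<close> tends to infinity, the constant \<open>a\<close>
  disappears in the limit. With \<open>a = ln C\<close> this says that constant factors in covering
  estimates do not affect the dimension.\<close>

lemma log_ratio_tendsto:
  fixes a s :: real
  shows "((\<lambda>\<epsilon>. (a + s * ln (1/\<epsilon>)) / ln (1/\<epsilon>)) \<longlongrightarrow> s) (at_right 0)"
proof -
  have "filterlim (\<lambda>\<epsilon>::real. ln (inverse \<epsilon>)) at_top (at_right 0)"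
    by (rule filterlim_compose[OF ln_at_top filterlim_inverse_at_top_right])
  then have lim: "filterlim (\<lambda>\<epsilon>::real. ln (1/\<epsilon>)) at_top (at_right 0)"
    by (simp add: inverse_eq_divide)
  have "((\<lambda>\<epsilon>. a / ln (1/\<epsilon>) + s) \<longlongrightarrow> 0 + s) (at_right 0)"
    by (intro tendsto_add tendsto_const tendsto_divide_0[OF tendsto_const]
        filterlim_at_top_imp_at_infinity[OF lim])
  moreover have "\<forall>\<^sub>F \<epsilon> in at_right 0. a / ln (1/\<epsilon>) + s = (a + s * ln (1/\<epsilon>)) / ln (1/\<epsilon>)"
    using filterlim_at_top_dense[THEN iffD1, OF lim, rule_format, of 0]
    by eventually_elim (simp add: field_simps)
  ultimately show ?thesis
    by (simp add: tendsto_cong)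
qed

lemma upper_box_dim_le:
  assumes C: "C > 0" and N: "\<forall>\<^sub>F \<epsilon> in at_right 0. real (covering_number \<epsilon> E) \<le> C * \<epsilon> powr (- s)"
  shows "upper_box_dim E \<le> ennreal s"
proof -
  have "\<forall>\<^sub>F \<epsilon>::real in at_right 0. 0 < \<epsilon> \<and> \<epsilon> < 1"
    using eventually_at_right_real[of 0 "1::real"] by simp
  with N have "\<forall>\<^sub>F \<epsilon> in at_right 0. ennreal (ln (real (covering_number \<epsilon> E)) / ln (1/\<epsilon>))
      \<le> ennreal ((ln C + s * ln (1/\<epsilon>)) / ln (1/\<epsilon>))"
  proof eventually_elim
    case (elim \<epsilon>)
    show ?case
    \<comment> \<open>\<open>ln_mono\<close> needs a positive argument. For covering number 0 the
      left side is 0, because \<open>ln 0 = 0\<close> in HOL.\<close>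
    proof (cases "covering_number \<epsilon> E = 0")
      case False
      have "ln (real (covering_number \<epsilon> E)) \<le> ln (C * \<epsilon> powr (- s))"
        using elim False C by (intro ln_mono) auto
      also have "\<dots> = ln C + s * ln (1/\<epsilon>)"
        using elim C by (simp add: ln_mult ln_div)
      finally show ?thesis
        using elim by (intro ennreal_leI divide_right_mono) auto
    qed simp
  qed
  then have "upper_box_dim E
      \<le> Limsup (at_right 0) (\<lambda>\<epsilon>. ennreal ((ln C + s * ln (1/\<epsilon>)) / ln (1/\<epsilon>)))"
    unfolding upper_box_dim_def by (rule Limsup_mono)
  also have "\<dots> = ennreal s"
    by (intro lim_imp_Limsup tendsto_ennrealI log_ratio_tendsto) simp
  finally show ?thesis .
qed

text \<open>A limit superior is bounded below by the limit along any one sequence of scales, so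
  estimates at the scales \<open>e m\<close> alone suffice.\<close>

lemma upper_box_dim_ge:
  fixes e :: "nat \<Rightarrow> real"
  assumes C: "C > 0" and e: "\<And>m. e m > 0" "e \<longlonglongrightarrow> 0"
    and N: "\<And>m. C * e m powr (- s) \<le> real (covering_number (e m) E)"
  shows "ennreal s \<le> upper_box_dim E"
proof -
  let ?f = "\<lambda>\<epsilon>. ennreal (ln (real (covering_number \<epsilon> E)) / ln (1/\<epsilon>))"
  let ?g = "\<lambda>\<epsilon>. ennreal ((ln C + s * ln (1/\<epsilon>)) / ln (1/\<epsilon>))"
  have lim_e: "filterlim e (at_right 0) sequentially"
    using e by (intro filterlim_at_withinI always_eventually) auto
  have lim_g: "(\<lambda>m. ?g (e m)) \<longlonglongrightarrow> ennreal s"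
    by (intro tendsto_ennrealI filterlim_compose[OF log_ratio_tendsto lim_e])
  have small: "\<forall>\<^sub>F m in sequentially. e m < 1"
    by (rule order_tendstoD(2)[OF e(2)]) simp
  have le: "?g (e m) \<le> ?f (e m)" if "e m < 1" for m
  proof -
    have "ln C + s * ln (1 / e m) = ln (C * e m powr (- s))"
      using e(1)[of m] C by (simp add: ln_mult ln_div)
    also have "\<dots> \<le> ln (real (covering_number (e m) E))"
      using N[of m] C e(1)[of m] by (intro ln_mono) auto
    finally show ?thesis
      using e(1)[of m] that by (intro ennreal_leI divide_right_mono) auto
  qed
  \<comment> \<open>\<open>Limsup\<close> is the infimum of these suprema over all eventually true
    \<open>P\<close>. Each such \<open>P\<close> holds at \<open>e m\<close> for large
    \<open>m\<close>, so its supremum dominates the limit of \<open>?g (e m)\<close>.\<close>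
  have "ennreal s \<le> (SUP \<epsilon>\<in>{\<epsilon>. P \<epsilon>}. ?f \<epsilon>)" if "eventually P (at_right 0)" for P
  proof (rule tendsto_upperbound[OF lim_g])
    have "\<forall>\<^sub>F m in sequentially. P (e m)"
      using lim_e that by (simp add: filterlim_iff)
    with small show "\<forall>\<^sub>F m in sequentially. ?g (e m) \<le> (SUP \<epsilon>\<in>{\<epsilon>. P \<epsilon>}. ?f \<epsilon>)"
      by eventually_elim (use le in \<open>auto intro: SUP_upper2\<close>)
  qed simp
  then show ?thesis
    unfolding upper_box_dim_def Limsup_def by (auto intro: INF_greatest)
qed

lemma upper_box_dim_mono:
  fixes E :: "'a::euclidean_space set"
  assumes "E \<subseteq> E'" "bounded E'"
  shows "upper_box_dim E \<le> upper_box_dim E'"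
  unfolding upper_box_dim_def
proof (rule Limsup_mono)
  have "\<forall>\<^sub>F \<epsilon>::real in at_right 0. 0 < \<epsilon> \<and> \<epsilon> < 1"
    using eventually_at_right_real[of 0 "1::real"] by simp
  then show "\<forall>\<^sub>F \<epsilon> in at_right 0. ennreal (ln (real (covering_number \<epsilon> E)) / ln (1/\<epsilon>))
      \<le> ennreal (ln (real (covering_number \<epsilon> E')) / ln (1/\<epsilon>))"
  proof eventually_elim
    case (elim \<epsilon>)
    have le: "covering_number \<epsilon> E \<le> covering_number \<epsilon> E'"
      using covering_number_mono[OF assms] elim by simp
    show ?case
    proof (cases "covering_number \<epsilon> E = 0")
      case False
      then have "ln (real (covering_number \<epsilon> E)) \<le> ln (real (covering_number \<epsilon> E'))"
        using le by (intro ln_mono) auto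
      then show ?thesis
        using elim by (intro ennreal_leI divide_right_mono) auto
    qed simp
  qed
qed

section \<open>Point-extended box dimension: monotonicity and upper bound\<close>

lemma pbox_dim_mono:
  fixes E :: "'a::euclidean_space set"
  assumes "E \<subseteq> E'"
  shows "pbox_dim x E \<le> pbox_dim x E'"
proof (cases "x \<in> closure E")
  case True
  moreover have "x \<in> closure E'"
    using True closure_mono[OF assms] by blast
  moreover have "upper_box_dim (E \<inter> ball x r) \<le> upper_box_dim (E' \<inter> ball x r)" for r
    using assms by (intro upper_box_dim_mono) auto
  ultimately show ?thesis
    unfolding pbox_dim_def by (auto intro: INF_mono)
qed (simp add: pbox_dim_def)

lemma powr_divide_conv_mult:
  fixes a b p :: real
  assumes "0 < a" "0 < b"
  shows "(a / b) powr p = a powr p * b powr (- p)"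
  using assms by (simp add: powr_divide powr_minus_divide)

text \<open>\<open>pbox_dim\<close> is an infimum over radii, so the estimate at a single admissible
  radius is enough. The factor \<open>R powr (D + \<eta>)\<close> joins the constant, and \<eta> is
  arbitrary.\<close>

lemma pbox_dim_le_of_covering_control:
  assumes "upper_box_covering_control A x D"
  shows "pbox_dim x A \<le> ennreal D"
proof (rule ennreal_le_epsilon)
  fix \<eta> :: real assume \<eta>: "\<eta> > 0"
  obtain R\<^sub>0 where R0: "R\<^sub>0 > 0" and control: "\<forall>R. 0 < R \<and> R < R\<^sub>0 \<longrightarrow> (\<forall>\<eta>>0. \<exists>C>0. \<exists>\<epsilon>\<^sub>0>0.
      \<forall>\<epsilon>. 0 < \<epsilon> \<and> \<epsilon> < \<epsilon>\<^sub>0 \<longrightarrow>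
        real (covering_number \<epsilon> (A \<inter> ball x R)) \<le> C * (R / \<epsilon>) powr (D + \<eta>))"
    using assms unfolding upper_box_covering_control_def by (elim conjE exE) (rule that)
  have D: "D \<ge> 0"
    using assms by (simp add: upper_box_covering_control_def)
  define R where "R = R\<^sub>0 / 2"
  have R: "0 < R" "R < R\<^sub>0"
    using R0 by (auto simp: R_def)
  obtain C \<epsilon>\<^sub>0 where C: "C > 0" "\<epsilon>\<^sub>0 > 0" and N: "\<And>\<epsilon>. 0 < \<epsilon> \<Longrightarrow> \<epsilon> < \<epsilon>\<^sub>0 \<Longrightarrow>
      real (covering_number \<epsilon> (A \<inter> ball x R)) \<le> C * (R / \<epsilon>) powr (D + \<eta>)"
    using control[THEN spec, THEN mp, OF conjI[OF R], THEN spec, THEN mp, OF \<eta>] by blast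
  have "\<forall>\<^sub>F \<epsilon> in at_right 0. 0 < \<epsilon> \<and> \<epsilon> < \<epsilon>\<^sub>0"
    using eventually_at_right_real[OF C(2)] by simp
  then have "\<forall>\<^sub>F \<epsilon> in at_right 0. real (covering_number \<epsilon> (A \<inter> ball x R))
      \<le> (C * R powr (D + \<eta>)) * \<epsilon> powr (- (D + \<eta>))"
  proof eventually_elim
    case (elim \<epsilon>)
    then show ?case
      using N[of \<epsilon>] R by (simp add: powr_divide_conv_mult mult.assoc)
  qed
  then have "upper_box_dim (A \<inter> ball x R) \<le> ennreal (D + \<eta>)"
    by (rule upper_box_dim_le[rotated]) (use C R in simp)
  moreover have "pbox_dim x A \<le> upper_box_dim (A \<inter> ball x R)"
    using R by (auto simp: pbox_dim_def intro: INF_lower)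
  ultimately show "pbox_dim x A \<le> ennreal D + ennreal \<eta>"
    using D \<eta> by (simp add: ennreal_plus)
qed

text \<open>Each probe sees only a subset of \<open>A\<close>. The bound serves to show that
  contributions are finite.\<close>

lemma proj_contribution_le_pbox_dim: "proj_contribution x A \<xi> \<le> pbox_dim x A"
  unfolding proj_contribution_def dir_contribution_def
  by (auto intro!: SUP_least pbox_dim_mono)

subsection \<open>Product grids\<close>

text \<open>In \<open>grid\<close> the values of \<open>t\<close> outside \<open>{1..k}\<close> are
  arbitrary. Restricting to extensional functions removes this ambiguity, so that grid points can be
  counted.\<close>

lemma grid_eq_image_PiE:
  "grid x k v P = (\<lambda>t. x + (\<Sum>i=1..k. t i *\<^sub>R v i)) ` PiE {1..k} P"
proof (intro equalityI subsetI)
  fix y assume "y \<in> grid x k v P"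
  then obtain t where t: "y = x + (\<Sum>i=1..k. t i *\<^sub>R v i)" "\<forall>i\<in>{1..k}. t i \<in> P i"
    by (auto simp: grid_def)
  have "y = x + (\<Sum>i=1..k. restrict t {1..k} i *\<^sub>R v i)"
    using t(1) by simp
  moreover have "restrict t {1..k} \<in> PiE {1..k} P"
    using t(2) by auto
  ultimately show "y \<in> (\<lambda>t. x + (\<Sum>i=1..k. t i *\<^sub>R v i)) ` PiE {1..k} P"
    by blast
qed (auto simp: grid_def)

lemma lin_indep_family_coeffs_zero:
  assumes "lin_indep_family k v" "(\<Sum>i=1..k. a i *\<^sub>R v i) = 0" "i \<in> {1..k}"
  shows "a i = 0"
proof -
  have inj: "inj_on v {1..k}" and indep: "independent (v ` {1..k})"
    using assms(1) by (auto simp: lin_indep_family_def)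
  let ?u = "\<lambda>w. a (inv_into {1..k} v w)"
  have "(\<Sum>w\<in>v ` {1..k}. ?u w *\<^sub>R w) = (\<Sum>i=1..k. a i *\<^sub>R v i)"
    using inj by (simp add: sum.reindex)
  then have "?u (v i) = 0"
    using independentD[OF indep, of "v ` {1..k}" ?u "v i"] assms(2,3) by simp
  then show ?thesis
    using inj assms(3) by simp
qed

lemma card_grid:
  assumes "lin_indep_family k v"
  shows "card (grid x k v P) = (\<Prod>i=1..k. card (P i))"
proof -
  have "inj_on (\<lambda>t. x + (\<Sum>i=1..k. t i *\<^sub>R v i)) (PiE {1..k} P)"
  proof (rule inj_onI)
    fix s t assume st: "s \<in> PiE {1..k} P" "t \<in> PiE {1..k} P"
      "x + (\<Sum>i=1..k. s i *\<^sub>R v i) = x + (\<Sum>i=1..k. t i *\<^sub>R v i)"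
    then have "(\<Sum>i=1..k. (s i - t i) *\<^sub>R v i) = 0"
      by (simp add: scaleR_left_diff_distrib sum_subtractf)
    then have "s i = t i" if "i \<in> {1..k}" for i
      using lin_indep_family_coeffs_zero[OF assms, of "\<lambda>i. s i - t i"] that by simp
    then show "s = t"
      by (rule PiE_ext[OF st(1,2)])
  qed
  then show ?thesis
    by (simp add: grid_eq_image_PiE card_image card_PiE)
qed

text \<open>The grid has as many points as the product of its coordinate sets. Each of the
  \<open>k\<close> factors loses \<eta> in the exponent, which gives the total loss
  \<open>real k * \<eta>\<close>.\<close>

lemma upper_box_dim_ge_of_product_grid:
  assumes grid: "product_grid_realization A x k v d" and r: "r > 0" and \<eta>: "\<eta> > 0"
  shows "ennreal ((\<Sum>i=1..k. d i) - real k * \<eta>) \<le> upper_box_dim (A \<inter> ball x r)"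
proof -
  let ?s = "(\<Sum>i=1..k. d i) - real k * \<eta>"
  have indep: "lin_indep_family k v"
    using grid by (simp add: product_grid_realization_def)
  obtain C c where C: "C \<ge> 1" and c: "c > 0" and
    grids: "\<forall>\<rho>\<^sub>0>0. \<forall>\<rho>. 0 < \<rho> \<and> \<rho> < \<rho>\<^sub>0 \<longrightarrow> (\<forall>\<eta>>0.
      \<exists>(\<epsilon> :: nat \<Rightarrow> real) (P :: nat \<Rightarrow> nat \<Rightarrow> real set).
        decseq \<epsilon> \<and> \<epsilon> \<longlonglongrightarrow> 0 \<and>
        (\<forall>m. 0 < \<epsilon> m \<and> \<epsilon> m < \<rho> \<and>
          (\<forall>i\<in>{1..k}. finite (P i m) \<and> P i m \<subseteq> {-\<rho>..\<rho>} \<and>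
             real (card (P i m)) \<ge> (\<rho> / \<epsilon> m) powr (d i - \<eta>)) \<and>
          grid x k v (\<lambda>i. P i m) \<subseteq> A \<inter> ball x (C * \<rho>) \<and>
          separated_by (c * \<epsilon> m) (grid x k v (\<lambda>i. P i m))))"
    using grid unfolding product_grid_realization_def by (elim conjE exE) (rule that)
  \<comment> \<open>Chosen so that the ball of radius \<open>C * \<rho>\<close> containing the grid
    is exactly \<open>ball x r\<close>.\<close>
  define \<rho> where "\<rho> = r / C"
  have \<rho>: "0 < \<rho>" "C * \<rho> = r"
    using C r by (auto simp: \<rho>_def)
  obtain \<epsilon> P where lim: "\<epsilon> \<longlonglongrightarrow> 0" and \<epsilon>: "\<And>m. 0 < \<epsilon> m"
    and P: "\<And>m i. i \<in> {1..k} \<Longrightarrow> real (card (P i m)) \<ge> (\<rho> / \<epsilon> m) powr (d i - \<eta>)"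
    and sub: "\<And>m. grid x k v (\<lambda>i. P i m) \<subseteq> A \<inter> ball x r"
    and sep: "\<And>m. separated_by (c * \<epsilon> m) (grid x k v (\<lambda>i. P i m))"
  proof -
    have "0 < 2 * \<rho>" "0 < \<rho> \<and> \<rho> < 2 * \<rho>"
      using \<rho> by auto
    from grids[THEN spec, THEN mp, OF this(1), THEN spec, THEN mp, OF this(2), THEN spec,
        THEN mp, OF \<eta>]
    show thesis
      unfolding \<rho>(2) by (elim exE conjE) (rule that, auto)
  qed
  \<comment> \<open>Half the separation constant makes \<open>e m\<close> strictly smaller than the
    separation \<open>c * \<epsilon> m\<close>.\<close>
  define e where "e m = c / 2 * \<epsilon> m" for m
  \<comment> \<open>The constant compensates for the change of scale:
    \<open>(\<rho> * c / 2) / e m = \<rho> / \<epsilon> m\<close>.\<close>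
  have "(\<rho> * c / 2) powr ?s * e m powr (- ?s) \<le> real (covering_number (e m) (A \<inter> ball x r))" for m
  proof -
    have "(\<rho> * c / 2) powr ?s * e m powr (- ?s) = ((\<rho> * c / 2) / e m) powr ?s"
      using \<epsilon>[of m] \<rho> c by (intro powr_divide_conv_mult[symmetric]) (auto simp: e_def)
    also have "\<dots> = (\<rho> / \<epsilon> m) powr (\<Sum>i=1..k. d i - \<eta>)"
      using c by (simp add: e_def sum_subtractf field_simps)
    also have "\<dots> = (\<Prod>i=1..k. (\<rho> / \<epsilon> m) powr (d i - \<eta>))"
      using \<rho> \<epsilon>[of m] by (intro powr_sum) auto
    also have "\<dots> \<le> (\<Prod>i=1..k. real (card (P i m)))"
      using P by (intro prod_mono) auto
    also have "\<dots> = real (card (grid x k v (\<lambda>i. P i m)))"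
      by (simp add: card_grid[OF indep])
    also have "\<dots> \<le> real (covering_number (e m) (A \<inter> ball x r))"
      using card_separated_le_covering_number[OF sep sub, of "e m" m] \<epsilon>[of m] c
      by (simp add: e_def bounded_Int)
    finally show ?thesis .
  qed
  moreover have "e \<longlonglongrightarrow> 0"
    using tendsto_mult_left[OF lim, of "c / 2"] by (simp add: e_def[abs_def])
  ultimately show ?thesis
    using c \<epsilon> \<rho> by (intro upper_box_dim_ge[of "(\<rho> * c / 2) powr ?s" e]) (auto simp: e_def)
qed

text \<open>At a fixed radius let \<eta> tend to 0, then take the infimum over radii;
  \<open>x \<in> closure A\<close> excludes the default value 0 of \<open>pbox_dim\<close>.\<close>

lemma pbox_dim_ge_of_product_grid:
  assumes "x \<in> closure A" "product_grid_realization A x k v d"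
  shows "ennreal (\<Sum>i=1..k. d i) \<le> pbox_dim x A"
proof -
  have "ennreal (\<Sum>i=1..k. d i) \<le> upper_box_dim (A \<inter> ball x r)" if r: "r > 0" for r
  proof (rule tendsto_upperbound)
    have "((\<lambda>\<eta>. (\<Sum>i=1..k. d i) - real k * \<eta>) \<longlongrightarrow> (\<Sum>i=1..k. d i) - real k * 0) (at_right 0)"
      by (intro tendsto_intros)
    then show "((\<lambda>\<eta>. ennreal ((\<Sum>i=1..k. d i) - real k * \<eta>)) \<longlongrightarrow> ennreal (\<Sum>i=1..k. d i))
        (at_right 0)"
      by (intro tendsto_ennrealI) simp
    show "\<forall>\<^sub>F \<eta> in at_right 0. ennreal ((\<Sum>i=1..k. d i) - real k * \<eta>)
        \<le> upper_box_dim (A \<inter> ball x r)"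
      by (intro eventually_at_right_less[THEN eventually_mono]
          upper_box_dim_ge_of_product_grid[OF assms(2) r])
  qed simp
  then show ?thesis
    using assms(1) by (auto simp: pbox_dim_def intro: INF_greatest)
qed

theorem corollary5p21:
  fixes A :: "(real^'n) set" and x :: "real^'n"
    and k :: nat and \<xi> :: "nat \<Rightarrow> (real^'n) set" and v :: "nat \<Rightarrow> real^'n"
    and d :: "nat \<Rightarrow> real" and D :: real
  assumes "x \<in> closure A"
    and "exhaustive_packet x A k \<xi>"
    and "\<And>i. i \<in> {1..k} \<Longrightarrow> d i = enn2real (proj_contribution x A (\<xi> i))"
    and "D = (\<Sum>i=1..k. d i)"
    and "\<And>i. i \<in> {1..k} \<Longrightarrow> v i \<in> \<xi> i \<and> norm (v i) = 1"
    and "product_grid_realization A x k v d"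
    and "upper_box_covering_control A x D"
  shows "pbox_dim x A = cross_dim x A \<and> cross_dim x A = ennreal D"
proof -
  have le: "pbox_dim x A \<le> ennreal D"
    by (rule pbox_dim_le_of_covering_control[OF assms(7)])
  \<comment> \<open>\<open>enn2real\<close> sends infinity to 0, so finiteness must be known before
    \<open>d i\<close> can be converted back.\<close>
  have "proj_contribution x A (\<xi> i) = ennreal (d i)" if "i \<in> {1..k}" for i
  proof -
    have "proj_contribution x A (\<xi> i) \<le> ennreal D"
      using proj_contribution_le_pbox_dim le by (rule order_trans)
    then have "proj_contribution x A (\<xi> i) < \<infinity>"
      using le_less_trans[OF _ ennreal_less_top] by simp
    then show ?thesis
      using assms(3)[OF that] by simp
  qed
  then have "cross_dim x A = (\<Sum>i=1..k. ennreal (d i))"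
    using assms(2) by (simp add: exhaustive_packet_def)
  \<comment> \<open>\<open>ennreal\<close> commutes with this sum because each \<open>d i\<close>,
    being a value of \<open>enn2real\<close>, is nonnegative.\<close>
  also have "\<dots> = ennreal D"
    using assms(3,4) by simp
  finally have "cross_dim x A = ennreal D" .
  moreover have "pbox_dim x A = ennreal D"
    using le pbox_dim_ge_of_product_grid[OF assms(1,6)] assms(4) by simp
  ultimately show ?thesis
    by simp
qed

end
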